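(* Let $n\ge1$, $l\in\{0,\dots,2n\}$ and $t\in\{0,\dots,n\}$ be such that $0\le t\le\min\{l,2n-l\}$ and $l-t$ is even. Let $\mathbf a=(a_1,\dots,a_t)\in SpT_{2n}(\varpi_t)$ be such that $\mathbf s(a_i)\notin\mathbf a$ for every $1\le i\le t$. Define integers $l_1,\dots,l_{t+1}$ by (if $t\ge1$) $$l_1=\begin{cases}\min\{a_1-2,\ l-t\},& a_1\text{ even}\\ \min\{a_1-1,\ l-t\},& a_1\text{ odd,}\end{cases}$$ for $1\le i<t$, $$l_{i+1}=\begin{cases}\min\{a_{i+1}-a_i-2,\ l-t-\sum_{k=1}^i l_k\},& a_i,a_{i+1}\text{ both even or both odd}\\ \min\{a_{i+1}-a_i-1,\ l-t-\sum_{k=1}^i l_k\},& a_i\text{ even},\ a_{i+1}\text{ odd}\\ \min\{a_{i+1}-a_i-3,\ l-t-\sum_{k=1}^i l_k\},& a_i\text{ odd},\ a_{i+1}\text{ even,}\end{cases}$$ and $l_{t+1}=l-t-\sum_{i=1}^t l_i$ (so $l_1=l$ if $t=0$). Then $l_1,\dots,l_{t+1}$ are nonnegative even numbers. Put $T_0=(1,2,\dots,l_1)$ and, for $1\le i\le t$, $$T_i=\begin{cases}(a_i+1,\ a_i+2,\dots,a_i+l_{i+1}),& a_i\text{ even}\\ (a_i+1+1,\ a_i+1+2,\dots,a_i+1+l_{i+1}),& a_i\text{ odd}\end{cases}$$ (empty if the corresponding $l$ is $0$), and let $T$ be the concatenation $$T=T_0\,(a_1)\,T_1\,(a_2)\,T_2\cdots(a_t)\,T_t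 .$$ Then $T\in SST_{2n}(\varpi_l)$ and $\mathrm{red}(T)=\mathbf a$; that is, $T=\mathrm{red}_t^{-1}(\mathbf a)$ is the unique preimage of $\mathbf a$ in $SST_{2n}(\varpi_l)$ under the reduction map.
   Context: $SST_{2n}(\varpi_l)$ is the set of columns of length $l$ on the alphabet $\{1,\dots,2n\}$, i.e. strictly increasing sequences $(b_1<\dots<b_l)$ with entries in $\{1,\dots,2n\}$, often identified with the set of entries. $SpT_{2n}(\varpi_t)\subseteq SST_{2n}(\varpi_t)$ is the subset of symplectic columns: $b_k\ge2k-1$ for all $k$. The parity involution is $\mathbf s(x)=x+1$ for $x$ odd, $\mathbf s(x)=x-1$ for $x$ even. For a column $\mathbf b=(b_1,\dots,b_l)$ the removal subword $\mathrm{rem}(\mathbf b)$ is defined recursively: $\mathrm{rem}(\mathbf b)=\emptyset$ if $l\le1$; if $l\ge2$, $b_l$ is even, $b_{l-1}=b_l-1$ and $b_l<2l-|\mathrm{rem}(b_1,\dots,b_{l-2})|-1$, then $\mathrm{rem}(\mathbf b)=\mathrm{rem}(b_1,\dots,b_{l-2})\cup\{b_{l-1},b_l\}$; otherwise $\mathrm{rem}(\mathbf b)=\mathrm{rem}(b_1,\dots,b_{l-1})$. The reduction of $\mathbf b$ is $\mathrm{red}(\mathbf b)=\mathbf b\setminus\mathrm{rem}(\mathbf b)$. It is known (Watanabe) that $\mathrm{red}$ is injective on $SST_{2n}(\varpi_l)$ and takes values in $\bigsqcup_t SpT_{2n}(\varpi_t)$ over $0\le t\le\min\{l,2n-l\}$,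 $l-t$ even; $\mathrm{red}_t^{-1}(\mathbf a)=T$ means $T\in SST_{2n}(\varpi_l)$ and $\mathrm{red}(T)=\mathbf a$. *)

theory Defs
  imports Main
begin

text \<open>A column is the strictly increasing list of its entries. Entries are integers, so that
  differences of entries are not truncated. List positions start at \<open>0\<close>: the entry \<open>b\<^sub>k\<close> of the
  mathematical notation is \<open>b ! (k - 1)\<close>.\<close>

definition SST :: "nat \<Rightarrow> nat \<Rightarrow> int list set" where
  "SST m l = {b. length b = l \<and> sorted_wrt (<) b \<and> set b \<subseteq> {1..int m}}"

text \<open>The condition \<open>b\<^sub>k \<ge> 2 k - 1\<close> for \<open>1 \<le> k \<le> t\<close> becomes \<open>b ! k \<ge> 2 k + 1\<close> for \<open>k < t\<close>.\<close>

definition SpT :: "nat \<Rightarrow> nat \<Rightarrow> int list set" where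
  "SpT n t = {b \<in> SST (2 * n) t. \<forall>k < t. b ! k \<ge> 2 * int k + 1}"

definition parity_inv :: "int \<Rightarrow> int" where
  "parity_inv x = (if odd x then x + 1 else x - 1)"

text \<open>The removal subword, as the set of its entries. The prefixes \<open>b\<^sub>1, \<dots>, b\<^bsub>l-1\<^esub>\<close> and
  \<open>b\<^sub>1, \<dots>, b\<^bsub>l-2\<^esub>\<close> are \<open>take (l - 1) b\<close> and \<open>take (l - 2) b\<close>.\<close>

function removal :: "int list \<Rightarrow> int set" where
  "removal b = (let l = length b in
     if l \<le> 1 then {}
     else if even (b ! (l - 1)) \<and> b ! (l - 2) = b ! (l - 1) - 1 \<and>
             b ! (l - 1) < 2 * int l - int (card (removal (take (l - 2) b))) - 1
          then removal (take (l - 2) b) \<union> {b ! (l - 2), b ! (l - 1)}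
     else removal (take (l - 1) b))"
  by pat_completeness auto
termination by (relation "measure length") auto

declare removal.simps [simp del]

definition reduction :: "int list \<Rightarrow> int list" where
  "reduction b = filter (\<lambda>x. x \<notin> removal b) b"

text \<open>The first argument of the minimum defining \<open>l\<^bsub>i+1\<^esub>\<close>, for \<open>0 \<le> i < t\<close>.\<close>

fun gap :: "int list \<Rightarrow> nat \<Rightarrow> int" where
  "gap a 0 = (if even (a ! 0) then a ! 0 - 2 else a ! 0 - 1)"
| "gap a (Suc i) =
    (if even (a ! i) \<longleftrightarrow> even (a ! Suc i) then a ! Suc i - a ! i - 2
     else if even (a ! i) then a ! Suc i - a ! i - 1
     else a ! Suc i - a ! i - 3)"

text \<open>\<open>block_len a l i\<close> is \<open>l\<^bsub>i+1\<^esub>\<close>, for \<open>0 \<le> i \<le> t\<close> where \<open>t = length a\<close>; it is thus the length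
  of \<open>T\<^sub>i\<close>. The case \<open>i = t\<close> has no minimum.\<close>

function block_len :: "int list \<Rightarrow> nat \<Rightarrow> nat \<Rightarrow> int" where
  "block_len a l i =
    (let r = int l - int (length a) - (\<Sum>k<i. block_len a l k)
     in if i < length a then min (gap a i) r else r)"
  by pat_completeness auto
termination by (relation "measure (\<lambda>(a, l, i). i)") auto

declare block_len.simps [simp del]

fun block :: "int list \<Rightarrow> nat \<Rightarrow> nat \<Rightarrow> int list" where
  "block a l 0 = [1..block_len a l 0]"
| "block a l (Suc i) =
    (if even (a ! i) then [a ! i + 1..a ! i + block_len a l (Suc i)]
     else [a ! i + 1 + 1..a ! i + 1 + block_len a l (Suc i)])"

definition preimage_column :: "int list \<Rightarrow> nat \<Rightarrow> int list" where
  "preimage_column a l =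
    block a l 0 @ concat (map (\<lambda>i. a ! i # block a l (Suc i)) [0..<length a])"

end

theory Submission
  imports Defs
begin

text \<open>Cut \<open>{1..2n}\<close> into the pairs \<open>{2j - 1, 2j}\<close>. Counting shows that the removal subword of a
  column \<open>b\<close> consists of all pairs contained in \<open>b\<close> if and only if every pair to the left of a pair
  contained in \<open>b\<close> meets \<open>b\<close>. As \<open>a\<close> contains no pair, \<open>reduction b = a\<close> therefore says that \<open>b\<close> is
  obtained from \<open>a\<close> by adding an initial segment of the set of all pairs disjoint from \<open>a\<close>. The length
  \<open>l\<close> determines this segment, and \<open>preimage_column a l\<close> is a column of this form.\<close>

section \<open>The removal subword\<close>

lemma parity_inv_parity_inv [simp]: "parity_inv (parity_inv x) = x"
  by (auto simp: parity_inv_def)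

lemma inj_parity_inv: "inj parity_inv"
  by (metis injI parity_inv_parity_inv)

lemma mem_parity_inv_image_iff: "x \<in> parity_inv ` A \<longleftrightarrow> parity_inv x \<in> A"
  by (metis imageE imageI parity_inv_parity_inv)

text \<open>With even bounds the interval is a union of pairs.\<close>

lemma parity_inv_between_iff:
  assumes "even u" "even v"
  shows "u < parity_inv x \<and> parity_inv x \<le> v \<longleftrightarrow> u < x \<and> x \<le> v"
  using assms unfolding parity_inv_def by (simp split: if_splits) presburger

definition paired :: "int set \<Rightarrow> int set" where
  "paired A = {x \<in> A. parity_inv x \<in> A}"

text \<open>Inclusion-exclusion for \<open>A\<close> and its image, which meet in
  \<open>paired A\<close>. This turns the numerical test in \<open>removal\<close> into a count of
  the points covered by pairs meeting the column.\<close>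

lemma card_paired:
  assumes "finite A"
  shows "2 * card A = card (A \<union> parity_inv ` A) + card (paired A)"
proof -
  have "paired A = A \<inter> parity_inv ` A"
    by (auto simp: paired_def mem_parity_inv_image_iff)
  moreover have "card (parity_inv ` A) = card A"
    by (meson card_image inj_on_subset inj_parity_inv subset_UNIV)
  ultimately show ?thesis
    using card_Un_Int[of A "parity_inv ` A"] assms by simp
qed

lemma removal_Nil [simp]: "removal [] = {}"
  by (simp add: removal.simps)

lemma removal_single [simp]: "removal [x] = {}"
  by (simp add: removal.simps)

text \<open>The column has length \<open>length c + 2\<close>, so \<open>2 * l - 1\<close> becomes
  \<open>2 * length c + 3\<close>.\<close>

lemma removal_snoc_snoc:
  "removal (c @ [y, x]) =
    (if even x \<and> y = x - 1 \<and> x < 2 * int (length c) + 3 - int (card (removal c))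
     then removal c \<union> {y, x} else removal (c @ [y]))"
proof -
  have "(c @ [y, x]) ! Suc (length c) = x" "(c @ [y, x]) ! length c = y"
    by (simp_all add: nth_append)
  then show ?thesis
    by (subst removal.simps) (simp add: Let_def algebra_simps)
qed

text \<open>Both shorter prefixes get a hypothesis because \<open>removal\<close> recurses to one or
  the other.\<close>

lemma snoc_snoc_induct [case_names Nil single snoc_snoc]:
  assumes "P []" "\<And>x. P [x]" "\<And>c y x. P c \<Longrightarrow> P (c @ [y]) \<Longrightarrow> P (c @ [y, x])"
  shows "P b"
proof (induction b rule: length_induct)
  case (1 b)
  consider "b = []" | x where "b = [x]" | c y x where "b = c @ [y, x]"
    by (metis append.assoc append_Cons append_Nil rev_exhaust)
  then show ?case
    using 1 assms by cases auto
qed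

lemma removal_subset_paired: "removal b \<subseteq> paired (set b)"
  by (induction b rule: snoc_snoc_induct)
    (auto simp: removal_snoc_snoc paired_def parity_inv_def split: if_splits)

lemma parity_inv_mem_removal: "x \<in> removal b \<Longrightarrow> parity_inv x \<in> removal b"
  by (induction b rule: snoc_snoc_induct)
    (auto simp: removal_snoc_snoc parity_inv_def split: if_splits)

text \<open>If the last two entries are a pair \<open>{x - 1, x}\<close>, all earlier ones lie in
  \<open>{1..x - 2}\<close>. Once all pairs of the prefix are removed, the test for removing this
  pair succeeds exactly when the pairs meeting the prefix fill that interval. Otherwise the pair of
  the last entry lies beyond all earlier entries, and both sides reduce to the shorter
  prefix.\<close>

lemma removal_eq_paired_iff:
  assumes "sorted_wrt (<) b" "set b \<subseteq> {1..}"
  shows "removal b = paired (set b) \<longleftrightarrow>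
    (\<forall>x \<in> paired (set b). {1..x} \<subseteq> set b \<union> parity_inv ` set b)"
  using assms
proof (induction b rule: snoc_snoc_induct)
  case Nil
  show ?case by (simp add: paired_def)
next
  case (single x)
  have "paired (set [x]) = {}"
    by (auto simp: paired_def parity_inv_def)
  then show ?case by simp
next
  case (snoc_snoc c y x)
  let ?A = "set c" and ?B = "set (c @ [y, x])"
  have less: "y < x" "\<And>z. z \<in> ?A \<Longrightarrow> z < y" and pos: "\<And>z. z \<in> ?B \<Longrightarrow> 1 \<le> z"
    using snoc_snoc.prems by (auto simp: sorted_wrt_append)
  have IH: "removal c = paired ?A \<longleftrightarrow> (\<forall>x \<in> paired ?A. {1..x} \<subseteq> ?A \<union> parity_inv ` ?A)"
    "removal (c @ [y]) = paired (set (c @ [y])) \<longleftrightarrow>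
      (\<forall>x \<in> paired (set (c @ [y])). {1..x} \<subseteq> set (c @ [y]) \<union> parity_inv ` set (c @ [y]))"
    using snoc_snoc by (auto simp: sorted_wrt_append)
  show ?case
  proof (cases "even x \<and> y = x - 1")
    case True
    have s: "parity_inv x = y" "parity_inv y = x"
      using True by (auto simp: parity_inv_def)
    \<comment> \<open>As \<open>x - 2\<close> is even, an entry up to \<open>x - 2\<close> has its
      partner there too.\<close>
    have A: "?A \<union> parity_inv ` ?A \<subseteq> {1..x - 2}"
    proof -
      have "z \<in> {1..x - 2} \<and> parity_inv z \<in> {1..x - 2}" if "z \<in> ?A" for z
      proof -
        have "1 \<le> z" "z \<le> x - 2"
          using that less(2)[OF that] pos True by auto
        then show ?thesis
          using True unfolding parity_inv_def by (simp split: if_splits) presburger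
      qed
      then show ?thesis by auto
    qed
    have paired_B: "paired ?B = paired ?A \<union> {y, x}"
    proof -
      have "parity_inv z \<noteq> x \<and> parity_inv z \<noteq> y" if "z \<in> ?A" for z
        using A that True by fastforce
      then show ?thesis
        using s by (auto simp: paired_def)
    qed
    have pA: "paired ?A \<subseteq> {1..x - 2}" "removal c \<subseteq> {1..x - 2}"
      using A removal_subset_paired[of c] by (auto simp: paired_def)
    have len: "length c = card ?A"
      using snoc_snoc.prems by (simp add: sorted_wrt_append strict_sorted_iff distinct_card)
    have B: "?B \<union> parity_inv ` ?B = ?A \<union> parity_inv ` ?A \<union> {y, x}"
      using s by auto
    \<comment> \<open>The requirement at \<open>x\<close>, the largest paired entry, implies all the
      others.\<close>
    have rhs: "(\<forall>z \<in> paired ?B. {1..z} \<subseteq> ?B \<union> parity_inv ` ?B) \<longleftrightarrow>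
        ?A \<union> parity_inv ` ?A = {1..x - 2}" (is "?L \<longleftrightarrow> ?R")
    proof
      assume ?L
      then have "{1..x} \<subseteq> ?A \<union> parity_inv ` ?A \<union> {y, x}"
        using B paired_B by blast
      then have "{1..x - 2} \<subseteq> ?A \<union> parity_inv ` ?A"
        using True by fastforce
      then show ?R using A by blast
    next
      assume ?R
      moreover have "{1..z} \<subseteq> {1..x - 2} \<union> {y, x}" if "z \<in> paired ?B" for z
        using that paired_B pA True by auto
      ultimately show ?L using B by metis
    qed
    have card: "2 * int (length c) =
        int (card (?A \<union> parity_inv ` ?A)) + int (card (paired ?A))"
      using card_paired[of ?A] len by simp
    show ?thesis
      unfolding rhs
    proof
      assume eq: "removal (c @ [y, x]) = paired ?B"
      \<comment> \<open>Hence the equality forces the first branch of the recursion.\<close>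
      have "x \<notin> removal (c @ [y])"
        using removal_subset_paired[of "c @ [y]"] less by (force simp: paired_def)
      then have cond: "x < 2 * int (length c) + 3 - int (card (removal c))"
        and "removal c \<union> {y, x} = paired ?A \<union> {y, x}"
        using eq paired_B by (auto simp: removal_snoc_snoc split: if_splits)
      moreover have "y \<notin> {1..x - 2}" "x \<notin> {1..x - 2}"
        using True by auto
      ultimately have "removal c = paired ?A"
        using pA by blast
      \<comment> \<open>By \<open>card_paired\<close> the test says that \<open>x\<close> is less
        than this cardinality plus 3; the inclusion \<open>A\<close> then leaves only
        equality.\<close>
      then have "int (card (?A \<union> parity_inv ` ?A)) \<ge> x - 2"
        using cond card by simp
      then have "card (?A \<union> parity_inv ` ?A) \<ge> card {1..x - 2}"
        by simp
      then show "?A \<union> parity_inv ` ?A = {1..x - 2}"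
        using A by (meson card_seteq finite_atLeastAtMost_int)
    next
      assume R: "?A \<union> parity_inv ` ?A = {1..x - 2}"
      then have rc: "removal c = paired ?A"
        using IH(1) pA(1) by fastforce
      \<comment> \<open>Ensures that \<open>{1..x - 2}\<close> has exactly \<open>x - 2\<close>
        elements.\<close>
      have "x \<ge> 2"
        using True pos[of y] by simp
      then have "int (card (?A \<union> parity_inv ` ?A)) = x - 2"
        using R by simp
      then have "x < 2 * int (length c) + 3 - int (card (removal c))"
        using card rc by simp
      then show "removal (c @ [y, x]) = paired ?B"
        using True rc paired_B by (simp add: removal_snoc_snoc)
    qed
  next
    case False
    have s: "y < parity_inv x"
      using False less(1) by (auto simp: parity_inv_def)
    have x: "parity_inv z \<noteq> x" if "z \<in> set (c @ [y])" for z
    proof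
      assume "parity_inv z = x"
      then have "parity_inv x = z" by auto
      then show False using s that less(2)[of z] by fastforce
    qed
    have paired: "paired ?B = paired (set (c @ [y]))"
    proof -
      have "parity_inv x \<notin> set (c @ [y])"
        using s less(2) by fastforce
      moreover have "parity_inv x \<noteq> x"
        by (auto simp: parity_inv_def)
      ultimately show ?thesis
        using x by (auto simp: paired_def)
    qed
    have "{1..z} \<subseteq> ?B \<union> parity_inv ` ?B \<longleftrightarrow>
        {1..z} \<subseteq> set (c @ [y]) \<union> parity_inv ` set (c @ [y])"
      if "z \<in> paired (set (c @ [y]))" for z
    proof -
      have "z \<le> y"
        using that less(2) by (force simp: paired_def)
      then have "x \<notin> {1..z}" "parity_inv x \<notin> {1..z}"
        using s less(1) by auto
      moreover have "?B \<union> parity_inv ` ?B =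
          insert x (insert (parity_inv x) (set (c @ [y]) \<union> parity_inv ` set (c @ [y])))"
        by auto
      ultimately show ?thesis by (metis subset_insert)
    qed
    moreover have "removal (c @ [y, x]) = removal (c @ [y])"
      using False by (auto simp: removal_snoc_snoc)
    ultimately show ?thesis
      using IH(2) paired by simp
  qed
qed

section \<open>Preimages of a column containing no pair\<close>

text \<open>The union of the pairs in \<open>{1..m}\<close> that are disjoint from \<open>A\<close>, for even \<open>m\<close>.\<close>

definition free :: "nat \<Rightarrow> int set \<Rightarrow> int set" where
  "free m A = {1..int m} - (A \<union> parity_inv ` A)"

definition initial_in :: "int set \<Rightarrow> int set \<Rightarrow> bool" where
  "initial_in I E \<longleftrightarrow> I \<subseteq> E \<and> (\<forall>x \<in> I. \<forall>y \<in> E. y \<le> x \<longrightarrow> y \<in> I)"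

text \<open>Initial segments of a linearly ordered set are comparable by inclusion.\<close>

lemma initial_in_card_unique:
  assumes "initial_in I E" "initial_in J E" "finite E" "card I = card J"
  shows "I = J"
proof -
  have "I \<subseteq> J \<or> J \<subseteq> I"
    using assms(1,2) unfolding initial_in_def by (meson linear subset_iff)
  moreover have "finite I" "finite J"
    using assms unfolding initial_in_def by (auto intro: finite_subset)
  ultimately show ?thesis
    using assms(4) by (metis card_subset_eq)
qed

lemma SST_D:
  assumes "b \<in> SST m l"
  shows "sorted_wrt (<) b" "set b \<subseteq> {1..int m}" "length b = l" "card (set b) = l"
  using assms by (auto simp: SST_def strict_sorted_iff distinct_card)

text \<open>Removal takes whole pairs, so a pair of \<open>b\<close> that is not removed would
  survive as a pair in \<open>a\<close>. Hence all pairs of \<open>b\<close> are removed, and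
  \<open>removal_eq_paired_iff\<close> becomes a condition on the added entries.\<close>

lemma reduction_eq_iff:
  assumes a: "a \<in> SST m t" and b: "b \<in> SST m l" and unpaired: "paired (set a) = {}"
  shows "reduction b = a \<longleftrightarrow>
    set a \<subseteq> set b \<and> paired (set b) = set b - set a \<and> initial_in (set b - set a) (free m (set a))"
    (is "?L \<longleftrightarrow> ?R")
proof
  assume L: ?L
  then have set_a: "set a = set b - removal b"
    unfolding reduction_def by auto
  have "paired (set b) \<subseteq> removal b"
  proof
    fix x assume x: "x \<in> paired (set b)"
    show "x \<in> removal b"
    proof (rule ccontr)
      assume "x \<notin> removal b"
      moreover from this have "parity_inv x \<notin> removal b"
        using parity_inv_mem_removal by fastforce
      ultimately have "x \<in> paired (set a)"
        using x set_a by (auto simp: paired_def)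
      then show False using unpaired by simp
    qed
  qed
  then have rem: "removal b = paired (set b)"
    using removal_subset_paired by blast
  have paired: "paired (set b) = set b - set a"
    using set_a rem by (auto simp: paired_def)
  have "initial_in (set b - set a) (free m (set a))"
    unfolding initial_in_def
  proof (intro conjI ballI impI subsetI)
    fix x assume "x \<in> set b - set a"
    then have "x \<in> removal b" "x \<in> {1..int m}"
      using rem paired SST_D(2)[OF b] by auto
    then show "x \<in> free m (set a)"
      using parity_inv_mem_removal[of x b] set_a
      by (auto simp: free_def mem_parity_inv_image_iff)
  next
    fix x y assume x: "x \<in> set b - set a" and y: "y \<in> free m (set a)" and "y \<le> x"
    have "set b \<subseteq> {1..}"
      using SST_D(2)[OF b] by auto
    then have "{1..x} \<subseteq> set b \<union> parity_inv ` set b"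
      using x rem paired removal_eq_paired_iff[OF SST_D(1)[OF b]] by blast
    moreover have "y \<in> {1..x}"
      using y \<open>y \<le> x\<close> by (simp add: free_def)
    \<comment> \<open>Neither \<open>y\<close> nor its partner lies in \<open>a\<close>, so
      whichever of them is in \<open>b\<close> is a paired entry and brings in the other.\<close>
    ultimately have "y \<in> set b \<or> parity_inv y \<in> set b"
      by (auto simp: mem_parity_inv_image_iff)
    moreover have "y \<notin> set a" "parity_inv y \<notin> set a"
      using y by (auto simp: free_def mem_parity_inv_image_iff)
    moreover have "y \<in> set b" if "parity_inv y \<in> paired (set b)"
      using that by (simp add: paired_def)
    ultimately show "y \<in> set b - set a"
      using paired by blast
  qed
  then show ?R using set_a paired by blast
next
  assume R: ?R
  have "{1..x} \<subseteq> set b \<union> parity_inv ` set b" if x: "x \<in> paired (set b)" for x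
  proof
    fix y assume y: "y \<in> {1..x}"
    have "x \<le> int m"
      using x SST_D(2)[OF b] by (auto simp: paired_def)
    then have "y \<in> free m (set a) \<or> y \<in> set a \<union> parity_inv ` set a"
      using y unfolding free_def by simp linarith
    then show "y \<in> set b \<union> parity_inv ` set b"
    proof
      assume "y \<in> free m (set a)"
      then have "y \<in> set b - set a"
        using R x y unfolding initial_in_def by (metis atLeastAtMost_iff)
      then show ?thesis by blast
    qed (use R in blast)
  qed
  moreover have "set b \<subseteq> {1..}"
    using SST_D(2)[OF b] by auto
  ultimately have "removal b = set b - set a"
    using removal_eq_paired_iff[OF SST_D(1)[OF b]] R by blast
  then have "set (reduction b) = set a"
    using R unfolding reduction_def by auto
  moreover have "sorted_wrt (<) (reduction b)"
    unfolding reduction_def using SST_D(1)[OF b] by (rule sorted_wrt_filter)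
  ultimately show ?L
    using SST_D(1)[OF a] strict_sorted_equal by blast
qed

text \<open>The entries added to \<open>a\<close> form initial segments of the same finite set, and
  the lengths force equal cardinality.\<close>

lemma reduction_eq_unique:
  assumes a: "a \<in> SST m t" and unpaired: "paired (set a) = {}"
    and b: "b \<in> SST m l" "reduction b = a" and c: "c \<in> SST m l" "reduction c = a"
  shows "b = c"
proof -
  note eqs = reduction_eq_iff[OF a b(1) unpaired, THEN iffD1, OF b(2)]
    reduction_eq_iff[OF a c(1) unpaired, THEN iffD1, OF c(2)]
  have "card (set b - set a) = card (set c - set a)"
    using eqs SST_D(4)[OF b(1)] SST_D(4)[OF c(1)] by (simp add: card_Diff_subset)
  then have "set b - set a = set c - set a"
    using eqs by (intro initial_in_card_unique) (auto simp: free_def)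
  then have "set b = set c" using eqs by blast
  then show ?thesis
    using SST_D(1)[OF b(1)] SST_D(1)[OF c(1)] strict_sorted_equal by blast
qed

section \<open>The blocks of the preimage\<close>

text \<open>The even member of the pair containing the preceding entry of \<open>a\<close>, or 0
  before the first entry.\<close>

fun block_start :: "int list \<Rightarrow> nat \<Rightarrow> int" where
  "block_start a 0 = 0"
| "block_start a (Suc i) = (if even (a ! i) then a ! i else a ! i + 1)"

text \<open>The maximal \<open>i\<close>-th block avoiding all pairs that meet \<open>a\<close> is
  \<open>{block_start a i + 1..block_end n a i}\<close>.\<close>

definition block_end :: "nat \<Rightarrow> int list \<Rightarrow> nat \<Rightarrow> int" where
  "block_end n a i =
    (if i < length a then if even (a ! i) then a ! i - 2 else a ! i - 1 else 2 * int n)"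

lemma even_block_start [simp]: "even (block_start a i)"
  by (cases i) auto

lemma even_block_end [simp]: "even (block_end n a i)"
  by (auto simp: block_end_def)

text \<open>Rounding both ends to even numbers absorbs the parity cases of
  \<open>gap\<close>.\<close>

lemma gap_eq: "i < length a \<Longrightarrow> gap a i = block_end n a i - block_start a i"
  by (cases i) (auto simp: block_end_def)

lemma block_start_Suc: "i < length a \<Longrightarrow> block_start a (Suc i) = block_end n a i + 2"
  by (auto simp: block_end_def)

lemma nth_eq_end_start:
  "i < length a \<Longrightarrow>
    {a ! i, parity_inv (a ! i)} = {block_end n a i + 1, block_start a (Suc i)}"
  by (auto simp: block_end_def parity_inv_def)

lemma block_eq: "block a l i = [block_start a i + 1..block_start a i + block_len a l i]"
  by (cases i) auto

section \<open>The maximal blocks between the pairs meeting \<open>a\<close>\<close>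

locale unpaired_column =
  fixes n l :: nat and a :: "int list"
  assumes a: "a \<in> SST (2 * n) (length a)"
    and unpaired: "paired (set a) = {}"
    and length_le: "length a \<le> l" "l + length a \<le> 2 * n"
    and even_diff: "even (l - length a)"
begin

abbreviation (input) "t \<equiv> length a"
abbreviation (input) "s \<equiv> block_start a"
abbreviation (input) "e \<equiv> block_end n a"
abbreviation (input) "len \<equiv> block_len a l"

lemma nth_less: "i < j \<Longrightarrow> j < t \<Longrightarrow> a ! i < a ! j"
  using SST_D(1)[OF a] by (simp add: sorted_wrt_iff_nth_less)

lemma nth_bounds:
  assumes "i < t"
  shows "1 \<le> a ! i" "a ! i \<le> 2 * int n"
  using SST_D(2)[OF a] nth_mem[OF assms] by auto

lemma parity_inv_notin: "x \<in> set a \<Longrightarrow> parity_inv x \<notin> set a"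
  using unpaired by (auto simp: paired_def)

text \<open>Consecutive entries lie in different pairs, so the earlier pair ends before the later
  one begins. At the two extremes the bounds 1 and \<open>2 * n\<close> respect pair
  boundaries.\<close>

lemma start_le_end:
  assumes "i \<le> t"
  shows "s i \<le> e i"
proof (cases i)
  case 0
  then show ?thesis
    using assms nth_bounds[of 0] by (auto simp: block_end_def elim!: evenE)
next
  case (Suc j)
  show ?thesis
  proof (cases "i < t")
    case True
    have "parity_inv (a ! j) \<noteq> a ! i"
      using parity_inv_notin[of "a ! j"] True Suc by (metis Suc_lessD nth_mem)
    moreover have "a ! j < a ! i"
      using True Suc nth_less by simp
    ultimately show ?thesis
      using True Suc by (auto simp: block_end_def parity_inv_def; presburger)
  next
    case False
    then have "i = t"
      using assms by simp
    moreover have "s i \<le> 2 * int n"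
      using Suc assms nth_bounds(2)[of j] by (simp; presburger)
    ultimately show ?thesis
      by (simp add: block_end_def)
  qed
qed

lemma end_less_nth: "i < t \<Longrightarrow> e i < a ! i"
  by (simp add: block_end_def)

lemma nth_le_start_Suc: "a ! i \<le> s (Suc i)"
  by simp

lemma end_le_start:
  assumes "i < j" "j \<le> t"
  shows "e i + 2 \<le> s j"
  using assms
proof (induction j)
  case (Suc j)
  have step: "s (Suc j) = e j + 2"
    using Suc.prems by (intro block_start_Suc) simp
  show ?case
  proof (cases "i = j")
    case False
    then have "e i + 2 \<le> s j" "s j \<le> e j"
      using Suc start_le_end by auto
    then show ?thesis
      using step by linarith
  qed (use step in simp)
qed simp

lemma free_eq: "free (2 * n) (set a) = (\<Union>i \<le> t. {s i + 1..e i})"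
proof (intro equalityI subsetI)
  fix y assume y: "y \<in> free (2 * n) (set a)"
  then have y': "1 \<le> y" "y \<le> 2 * int n" "y \<notin> set a" "parity_inv y \<notin> set a"
    by (auto simp: free_def mem_parity_inv_image_iff)
  \<comment> \<open>The first block whose right end is not passed by \<open>y\<close>. Between it
    and the preceding block lies only a pair meeting \<open>a\<close>, which \<open>y\<close>
    avoids.\<close>
  define i where "i = (LEAST i. y \<le> e i)"
  have "y \<le> e t"
    using y' by (simp add: block_end_def)
  then have i: "y \<le> e i" "i \<le> t"
    unfolding i_def by (auto intro: LeastI Least_le)
  have "s i + 1 \<le> y"
  proof (cases i)
    case (Suc j)
    then have "e j < y" "j < t"
      using i(2) not_less_Least[of j "\<lambda>i. y \<le> e i"] unfolding i_def[symmetric] by auto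
    moreover from this have "y \<notin> {e j + 1, s i}"
      using y' nth_eq_end_start[of j a n] Suc nth_mem[of j a]
      by (metis insert_iff parity_inv_parity_inv singletonD)
    ultimately show ?thesis
      using block_start_Suc[of j a n] Suc by auto
  qed (use y' in simp)
  then show "y \<in> (\<Union>i \<le> t. {s i + 1..e i})"
    using i by auto
next
  fix y assume "y \<in> (\<Union>i \<le> t. {s i + 1..e i})"
  then obtain i where i: "i \<le> t" "s i < y" "y \<le> e i"
    by auto
  \<comment> \<open>An entry \<open>a ! k\<close> lies at or before \<open>s i\<close> if
    \<open>k < i\<close>, and beyond \<open>e i\<close> otherwise.\<close>
  have notin: "z \<notin> set a" if z: "s i < z" "z \<le> e i" for z
  proof
    assume "z \<in> set a"
    then obtain k where k: "k < t" "z = a ! k"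
      by (auto simp: in_set_conv_nth)
    show False
    proof (cases "k < i")
      case True
      then have "s (Suc k) \<le> s i"
        using end_le_start[of k i] block_start_Suc[of k a n] i k by simp
      then show False
        using z k nth_le_start_Suc[of k] by linarith
    next
      case False
      then have "e i \<le> e k"
        using end_le_start[of i k] start_le_end[of k] k by (cases "i = k") auto
      then show False
        using z k end_less_nth[of k] by linarith
    qed
  qed
  have "s i < parity_inv y" "parity_inv y \<le> e i"
    using i parity_inv_between_iff[OF even_block_start even_block_end] by blast+
  moreover have "0 \<le> s i"
    using nth_bounds[of "i - 1"] i by (cases i) auto
  moreover have "e i \<le> 2 * int n"
    using nth_bounds(2)[of i] by (auto simp: block_end_def)
  ultimately show "y \<in> free (2 * n) (set a)"
    using i notin[of y] notin[of "parity_inv y"]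
    by (auto simp: free_def mem_parity_inv_image_iff)
qed

section \<open>Closed form of the block lengths\<close>

lemma sum_gap: "i \<le> t \<Longrightarrow> (\<Sum>k<i. gap a k) = s i - 2 * int i"
proof (induction i)
  case (Suc i)
  then show ?case
    using gap_eq[of i a n] block_start_Suc[of i a n] by simp
qed simp

text \<open>Subtracting \<open>min g r\<close> from \<open>r\<close> gives
  \<open>max 0 (r - g)\<close>, and as gaps are nonnegative the truncations accumulate into a single
  one. This eliminates the recursion of \<open>block_len\<close>.\<close>

lemma remaining_length:
  assumes "i \<le> t"
  shows "int l - int t - (\<Sum>k<i. len k) = max 0 (int l - int t - (\<Sum>k<i. gap a k))"
  using assms
proof (induction i)
  case 0
  then show ?case using length_le by simp
next
  case (Suc i)
  then have "len i = min (gap a i) (int l - int t - (\<Sum>k<i. len k))"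
    by (subst block_len.simps) (simp add: Let_def)
  moreover have "gap a i \<ge> 0"
    using gap_eq[of i a n] start_le_end[of i] Suc by simp
  ultimately show ?case
    using Suc by simp
qed

lemma block_len_eq:
  assumes "i \<le> t"
  shows "len i = min (e i - s i) (max 0 (int l - int t - s i + 2 * int i))"
proof (cases "i < t")
  case True
  then have "len i = min (gap a i) (int l - int t - (\<Sum>k<i. len k))"
    by (subst block_len.simps) (simp add: Let_def)
  then show ?thesis
    using True remaining_length[of i] sum_gap[of i] gap_eq[of i a n] by simp
next
  case False
  \<comment> \<open>The last block has no minimum in its definition, but \<open>l + t\<close> is at
    most \<open>2 * n\<close>, so the remaining length fits into it anyway.\<close>
  then have "len i = int l - int t - (\<Sum>k<i. len k)"
    by (subst block_len.simps) (simp add: Let_def)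
  moreover have "i = t"
    using False assms by simp
  moreover have "s t \<le> e t" "e t = 2 * int n"
    using start_le_end[of t] by (simp_all add: block_end_def)
  ultimately show ?thesis
    using remaining_length[of i] sum_gap[of i] length_le by simp
qed

lemma sum_block_len: "(\<Sum>k\<le>t. len k) = int l - int t"
  using block_len.simps[of a l t] by (simp add: Let_def lessThan_Suc_atMost[symmetric])

lemma block_len_nonneg: "i \<le> t \<Longrightarrow> 0 \<le> len i"
  using block_len_eq start_le_end by simp

lemma block_len_le: "i \<le> t \<Longrightarrow> s i + len i \<le> e i"
  using block_len_eq by simp

lemma even_block_len:
  assumes "i \<le> t"
  shows "even (len i)"
proof -
  have "even (int l - int t)"
    using even_diff length_le by (metis even_of_nat of_nat_diff)
  then show ?thesis
    unfolding block_len_eq[OF assms] by (auto simp: min_def max_def)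
qed

text \<open>Filling is greedy: length is left for block \<open>j\<close> only if the gaps before it,
  including that of block \<open>i\<close>, have been used up.\<close>

lemma block_len_full:
  assumes "i < j" "j \<le> t" "0 < len j"
  shows "s i + len i = e i"
proof -
  have "(\<Sum>k<j. gap a k) = (\<Sum>k<Suc i. gap a k) + (\<Sum>k=Suc i..<j. gap a k)"
    using assms by (metis Suc_leI atLeast0LessThan sum.atLeastLessThan_concat zero_le)
  moreover have "0 \<le> (\<Sum>k=Suc i..<j. gap a k)"
    using assms gap_eq[of _ a n] start_le_end by (intro sum_nonneg) simp
  ultimately have "s i - 2 * int i + (e i - s i) \<le> s j - 2 * int j"
    using assms sum_gap[of i] sum_gap[of j] gap_eq[of i a n] by simp
  moreover have "0 < int l - int t - s j + 2 * int j"
    using assms block_len_eq[of j] by linarith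
  ultimately show ?thesis
    using assms block_len_eq[of i] by simp
qed

section \<open>The added entries and the assembled column\<close>

definition filler :: "int set" where
  "filler = (\<Union>i \<le> t. {s i + 1..s i + len i})"

text \<open>Compare the block of \<open>y\<close> with that of \<open>x\<close>: an earlier block is
  full by \<open>block_len_full\<close>, and a later one would put \<open>y\<close> beyond
  \<open>x\<close>.\<close>

lemma initial_filler: "initial_in filler (free (2 * n) (set a))"
  unfolding initial_in_def
proof (intro conjI ballI impI)
  show "filler \<subseteq> free (2 * n) (set a)"
    unfolding filler_def free_eq using block_len_le by fastforce
next
  fix x y assume "x \<in> filler" "y \<in> free (2 * n) (set a)" and le: "y \<le> x"
  then obtain i j where i: "i \<le> t" "s i < y" "y \<le> e i"
    and j: "j \<le> t" "s j < x" "x \<le> s j + len j"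
    unfolding free_eq filler_def by auto
  have "y \<le> s i + len i"
  proof (cases i j rule: linorder_cases)
    case less
    then show ?thesis
      using block_len_full[of i j] i j by simp
  next
    case equal
    then show ?thesis using le j by simp
  next
    case greater
    then have "x < y"
      using end_le_start[of j i] block_len_le[of j] i j by simp
    then show ?thesis using le by simp
  qed
  then show "y \<in> filler"
    unfolding filler_def using i by (intro UN_I[of i]) simp_all
qed

lemma parity_inv_mem_filler:
  assumes "x \<in> filler"
  shows "parity_inv x \<in> filler"
proof -
  obtain i where i: "i \<le> t" "s i < x" "x \<le> s i + len i"
    using assms by (auto simp: filler_def)
  then have "s i < parity_inv x" "parity_inv x \<le> s i + len i"
    using parity_inv_between_iff[of "s i" "s i + len i" x] even_block_len by simp_all
  then show ?thesis
    unfolding filler_def using i by (intro UN_I[of i]) simp_all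
qed

text \<open>The upper bound on \<open>set p\<close> is carried along so that appending the next
  entry and block keeps the list increasing.\<close>

lemma prefix_props:
  assumes "i \<le> t"
  defines "p \<equiv> block a l 0 @ concat (map (\<lambda>i. a ! i # block a l (Suc i)) [0..<i])"
  shows "sorted_wrt (<) p \<and> int (length p) = int i + (\<Sum>k\<le>i. len k) \<and>
    set p = (!) a ` {..<i} \<union> (\<Union>k\<le>i. {s k + 1..s k + len k}) \<and>
    set p \<subseteq> {1..s i + len i}"
  using assms(1) unfolding p_def
proof (induction i)
  case 0
  then show ?case
    using block_len_nonneg[of 0] by (simp add: block_eq)
next
  case (Suc i)
  let ?p = "block a l 0 @ concat (map (\<lambda>i. a ! i # block a l (Suc i)) [0..<i])"
  let ?q = "block a l (Suc i)"
  have i: "i < t" using Suc.prems by simp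
  have IH: "sorted_wrt (<) ?p" "int (length ?p) = int i + (\<Sum>k\<le>i. len k)"
    "set ?p = (!) a ` {..<i} \<union> (\<Union>k\<le>i. {s k + 1..s k + len k})"
    "set ?p \<subseteq> {1..s i + len i}"
    using Suc.IH[OF less_imp_le[OF i]] by blast+
  have q: "sorted_wrt (<) ?q" "set ?q = {s (Suc i) + 1..s (Suc i) + len (Suc i)}"
    "int (length ?q) = len (Suc i)"
    using block_len_nonneg[of "Suc i"] Suc.prems by (simp_all only: block_eq) auto
  have bounds: "s i + len i < a ! i" "a ! i \<le> s (Suc i)" "0 \<le> len (Suc i)" "1 \<le> a ! i"
    using block_len_le[of i] end_less_nth[of i] nth_le_start_Suc[of i] nth_bounds[of i]
      block_len_nonneg[of "Suc i"] i by auto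
  have split: "block a l 0 @ concat (map (\<lambda>i. a ! i # block a l (Suc i)) [0..<Suc i]) =
      ?p @ a ! i # ?q"
    by simp
  have less: "x < a ! i" if "x \<in> set ?p" for x
    using that IH(4) bounds(1) by fastforce
  have greater: "a ! i < x" if "x \<in> set ?q" for x
    using that q(2) bounds(2) by fastforce
  have "sorted_wrt (<) (a ! i # ?q)"
    using q(1) greater by (simp del: block.simps)
  moreover have "x < y" if "x \<in> set ?p" "y \<in> set (a ! i # ?q)" for x y
    using less[OF that(1)] greater[of y] that(2) by (metis less_trans set_ConsD)
  ultimately have "sorted_wrt (<) (?p @ a ! i # ?q)"
    unfolding sorted_wrt_append[of _ ?p] using IH(1) by blast
  moreover have "int (length (?p @ a ! i # ?q)) = int (Suc i) + (\<Sum>k\<le>Suc i. len k)"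
    using IH(2) q(3) by (simp del: block.simps)
  moreover have "set (?p @ a ! i # ?q) =
      (!) a ` {..<Suc i} \<union> (\<Union>k\<le>Suc i. {s k + 1..s k + len k})"
    by (simp only: set_append[of ?p] IH(3) list.set q(2) lessThan_Suc atMost_Suc
        image_insert Union_insert Un_insert_left Un_insert_right Un_ac)
  moreover have "set (?p @ a ! i # ?q) \<subseteq> {1..s (Suc i) + len (Suc i)}"
    unfolding set_append list.set q(2) using IH(4) bounds by fastforce
  ultimately show ?case
    unfolding split by blast
qed

lemma set_preimage_column: "set (preimage_column a l) = set a \<union> filler"
proof -
  have "(!) a ` {..<t} = set a"
    by (auto simp: in_set_conv_nth)
  then show ?thesis
    using prefix_props[of t] by (simp only: preimage_column_def filler_def)
qed

lemma preimage_column_in_SST: "preimage_column a l \<in> SST (2 * n) l"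
proof -
  have "sorted_wrt (<) (preimage_column a l)"
    unfolding preimage_column_def using prefix_props[of t] by blast
  moreover have "int (length (preimage_column a l)) = int l"
    unfolding preimage_column_def using prefix_props[of t] sum_block_len by linarith
  moreover have "set (preimage_column a l) \<subseteq> {1..int (2 * n)}"
    using SST_D(2)[OF a] initial_filler
    by (auto simp: set_preimage_column initial_in_def free_def)
  ultimately show ?thesis by (simp add: SST_def)
qed

text \<open>The filler consists of whole pairs disjoint from \<open>a\<close>, and \<open>a\<close>
  contains no pair, so the pairs of the column make up exactly the filler.\<close>

lemma reduction_preimage_column: "reduction (preimage_column a l) = a"
proof -
  have disj: "x \<notin> set a" "parity_inv x \<notin> set a" if "x \<in> filler" for x
    using that initial_filler unfolding initial_in_def
    by (auto simp: free_def mem_parity_inv_image_iff)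
  then have diff: "set (preimage_column a l) - set a = filler"
    by (auto simp: set_preimage_column)
  have "paired (set (preimage_column a l)) = filler"
  proof (intro equalityI subsetI)
    fix x assume "x \<in> paired (set (preimage_column a l))"
    then have x: "x \<in> set a \<union> filler" "parity_inv x \<in> set a \<union> filler"
      by (simp_all add: paired_def set_preimage_column)
    show "x \<in> filler"
    proof (rule ccontr)
      assume "x \<notin> filler"
      then show False
        using x disj(2)[of "parity_inv x"] parity_inv_notin[of x] by auto
    qed
  qed (auto simp: paired_def set_preimage_column parity_inv_mem_filler)
  then show ?thesis
    unfolding reduction_eq_iff[OF a preimage_column_in_SST unpaired] diff
    using initial_filler by (simp add: set_preimage_column)
qed

end

theorem theorem2:
  fixes n l t :: nat and a :: "int list"
  assumes "n \<ge> 1" and "l \<le> 2 * n" and "t \<le> n"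
    and "t \<le> min l (2 * n - l)" and "even (l - t)"
    and "a \<in> SpT n t"
    and "\<forall>i < t. parity_inv (a ! i) \<notin> set a"
  shows "(\<forall>i \<le> t. block_len a l i \<ge> 0 \<and> even (block_len a l i))
    \<and> preimage_column a l \<in> SST (2 * n) l
    \<and> reduction (preimage_column a l) = a
    \<and> (\<forall>b \<in> SST (2 * n) l. reduction b = a \<longrightarrow> b = preimage_column a l)"
proof -
  have a: "a \<in> SST (2 * n) t" and t: "length a = t"
    using assms(6) by (auto simp: SpT_def SST_def)
  have unpaired: "paired (set a) = {}"
    using assms(7) t by (auto simp: paired_def in_set_conv_nth)
  \<comment> \<open>Since \<open>l\<close> is at most \<open>2 * n\<close>, the truncated bound on
    \<open>t\<close> gives the additive one of the locale.\<close>
  interpret unpaired_column n l a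
    using a t unpaired assms by unfold_locales auto
  show ?thesis
    using block_len_nonneg even_block_len preimage_column_in_SST reduction_preimage_column
      reduction_eq_unique[OF a unpaired] t by blast
qed

end
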